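(* Let $m\in\mathbb{N}$, let $\eta$ be a finite binomid index of length $m$, and let $\tilde\eta$ be its lex-minimal extension, with partial sums $(S_i)_{i\ge1}$ and averages $A_i=S_i/i$. Let $A_{\max}=\max\{A_i\mid 1\le i\le m\}$. If $k\in\{i\in\mathbb{N}\mid i\le m,\ A_i=A_{\max}\}$, then $km(m+1)/2$ is a preperiod of $\tilde\eta$.
   Context: $\mathbb{N}=\{1,2,3,\dots\}$. A sequence $(e_i)_{i\le m}$ of nonnegative integers, where $m\in\mathbb{N}$ (finite sequence of length $m$) or $m=\infty$ (infinite sequence indexed by $\mathbb{N}$), is a binomid index if $\sum_{i=n-k+1}^{n}e_i\ge\sum_{i=1}^k e_i$ for all $k,n\in\mathbb{N}$ with $1\le k\le n\le m$. Every finite binomid index $\eta$ extends to an infinite binomid index having $\eta$ as its initial segment; among all such extensions there is a unique lexicographically minimal one, denoted $\tilde\eta$ and called the lex-minimal extension of $\eta$. The partial sums of $(e_i)_{i\ge1}$ are $S_i=e_1+\dots+e_i$. It is known that $\tilde\eta$ is eventually periodic, i.e. $\tilde\eta=\eta_0(\eta_1)^\infty$ for some finite sequences $\eta_0$ (possibly empty) and $\eta_1$ (nonempty). A nonnegative integer $q$ is a preperiod of $\tilde\eta=(e_i)_{i\ge1}$ if $q=|\eta_0|$ for some such representation, i.e. if $(e_i)_{i>q}$ is purely periodic (preperiods are not required to be minimal). *)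

theory Defs
  imports Complex_Main "HOL-Library.Extended_Nat" "HOL-Library.Fun_Lexorder"
begin

(* Conventions.  A finite sequence (e_1, ..., e_m) is the list [e_1, ..., e_m].  An infinite
   sequence (e_1, e_2, ...) is a function e :: nat => nat with the index shifted by one: e i is
   the entry e_(i+1).  With this shift, e_1 + ... + e_k is the sum of e over {..<k}, and
   e_(n-k+1) + ... + e_n is the sum over {n-k..<n}. *)

(* Covers both finite (m = enat l) and infinite (m = \<infinity>) length; only the entries
   e i with enat i < m are constrained. *)
definition binomid_index :: "enat \<Rightarrow> (nat \<Rightarrow> nat) \<Rightarrow> bool" where
  "binomid_index m e \<longleftrightarrow>
     (\<forall>k n. 1 \<le> k \<longrightarrow> k \<le> n \<longrightarrow> enat n \<le> m \<longrightarrow> (\<Sum>i<k. e i) \<le> (\<Sum>i=n-k..<n. e i))"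

definition fin_binomid_index :: "nat list \<Rightarrow> bool" where
  "fin_binomid_index \<eta> \<longleftrightarrow>
     \<eta> \<noteq> [] \<and> binomid_index (enat (length \<eta>)) (\<lambda>i. \<eta> ! i)"

definition binomid_extension :: "nat list \<Rightarrow> (nat \<Rightarrow> nat) \<Rightarrow> bool" where
  "binomid_extension \<eta> e \<longleftrightarrow>
     binomid_index \<infinity> e \<and> (\<forall>i<length \<eta>. e i = \<eta> ! i)"

definition is_lex_min_extension :: "nat list \<Rightarrow> (nat \<Rightarrow> nat) \<Rightarrow> bool" where
  "is_lex_min_extension \<eta> e \<longleftrightarrow>
     binomid_extension \<eta> e \<and> (\<forall>f. binomid_extension \<eta> f \<longrightarrow> \<not> less_fun f e)"

definition lex_min_extension :: "nat list \<Rightarrow> nat \<Rightarrow> nat" where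
  "lex_min_extension \<eta> = (THE e. is_lex_min_extension \<eta> e)"

definition partial_sum :: "(nat \<Rightarrow> nat) \<Rightarrow> nat \<Rightarrow> nat" where
  "partial_sum e i = (\<Sum>j<i. e j)"

definition average :: "(nat \<Rightarrow> nat) \<Rightarrow> nat \<Rightarrow> real" where
  "average e i = real (partial_sum e i) / real i"

(* The infinite sequence u v v v ..., for a nonempty list v. *)
definition append_repeat :: "nat list \<Rightarrow> nat list \<Rightarrow> nat \<Rightarrow> nat" where
  "append_repeat u v i =
     (if i < length u then u ! i else v ! ((i - length u) mod length v))"

definition preperiod :: "nat \<Rightarrow> (nat \<Rightarrow> nat) \<Rightarrow> bool" where
  "preperiod q e \<longleftrightarrow> (\<exists>u v. length u = q \<and> v \<noteq> [] \<and> e = append_repeat u v)"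

(* Well-definedness of lex_min_extension: existence and uniqueness. *)

lemma binomid_index_cong:
  assumes "\<And>i. i < n \<Longrightarrow> e i = f i"
  shows "binomid_index (enat n) e \<longleftrightarrow> binomid_index (enat n) f"
proof -
  have *: "(\<Sum>i<k. e i) = (\<Sum>i<k. f i)" "(\<Sum>i=l-k..<l. e i) = (\<Sum>i=l-k..<l. f i)"
    if "k \<le> l" "l \<le> n" for k l
    using that assms by (auto intro!: sum.cong)
  show ?thesis
    unfolding binomid_index_def enat_ord_simps by (metis "*")
qed

lemma binomid_index_infinity_iff:
  "binomid_index \<infinity> e \<longleftrightarrow> (\<forall>n. binomid_index (enat n) e)"
  unfolding binomid_index_def by auto

lemma binomid_index_mono:
  "binomid_index (enat n) e \<Longrightarrow> l \<le> n \<Longrightarrow> binomid_index (enat l) e"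
  unfolding binomid_index_def by auto

lemma binomid_index_Suc_exists:
  assumes "binomid_index (enat n) e"
  shows "\<exists>x. binomid_index (enat (Suc n)) (e(n := x))"
proof
  let ?f = "e(n := (\<Sum>i<n. e i))"
  show "binomid_index (enat (Suc n)) ?f"
    unfolding binomid_index_def
  proof (intro allI impI)
    fix k l :: nat assume k: "1 \<le> k" "k \<le> l" and "enat l \<le> enat (Suc n)"
    then consider "l \<le> n" | "l = Suc n" "k = Suc n" | "l = Suc n" "k \<le> n"
      by (auto simp: le_Suc_eq)
    then show "(\<Sum>i<k. ?f i) \<le> (\<Sum>i=l-k..<l. ?f i)"
    proof cases
      case 1
      have "binomid_index (enat n) ?f"
        using assms by (subst binomid_index_cong[of n _ e]) auto
      then show ?thesis using 1 k by (auto simp: binomid_index_def)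
    next
      case 2
      then show ?thesis by (simp add: atLeast0LessThan)
    next
      case 3
      have "(\<Sum>i<k. ?f i) = (\<Sum>i<k. e i)" using 3 by (intro sum.cong) auto
      also have "\<dots> \<le> (\<Sum>i<n. e i)" using 3 by (intro sum_mono2) auto
      also have "\<dots> = ?f n" by simp
      also have "\<dots> \<le> (\<Sum>i=l-k..<l. ?f i)"
        using 3 k by (intro member_le_sum) auto
      finally show ?thesis .
    qed
  qed
qed

lemma lex_min_extension_unique_existence:
  assumes "fin_binomid_index \<eta>"
  shows "\<exists>!e. is_lex_min_extension \<eta> e"
proof -
  define m where "m = length \<eta>"
  define step where
    "step j e = e(m + j := (LEAST x. binomid_index (enat (Suc (m + j))) (e(m + j := x))))"
    for j :: nat and e :: "nat \<Rightarrow> nat"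
  define g where "g = rec_nat (\<lambda>i. \<eta> ! i) step"
  have g0: "g 0 = (\<lambda>i. \<eta> ! i)" and gS: "g (Suc j) = step j (g j)" for j
    by (simp_all add: g_def)
  have gb: "binomid_index (enat (m + j)) (g j)" for j
  proof (induction j)
    case 0
    then show ?case using assms by (simp add: g0 m_def fin_binomid_index_def)
  next
    case (Suc j)
    then show ?case
      using LeastI_ex[OF binomid_index_Suc_exists[OF Suc]]
      by (simp only: gS step_def add_Suc_right)
  qed
  have gstab: "g (j + d) i = g j i" if "i < m + j" for i j d
    using that by (induction d) (auto simp: gS step_def)
  define e where "e i = g (Suc i) i" for i
  have eg: "e i = g j i" if "i < m + j" for i j
  proof (cases "j \<le> Suc i")
    case True
    then show ?thesis using gstab[of i j "Suc i - j"] that by (simp add: e_def)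
  next
    case False
    then show ?thesis using gstab[of i "Suc i" "j - Suc i"] by (simp add: e_def)
  qed
  have ext: "binomid_extension \<eta> e"
    unfolding binomid_extension_def binomid_index_infinity_iff
  proof (intro conjI allI impI)
    fix n
    have "binomid_index (enat (m + n)) e"
      using gb[of n] eg[of _ n] binomid_index_cong[of "m + n" e "g n"] by auto
    then show "binomid_index (enat n) e" by (rule binomid_index_mono) simp
  next
    fix i assume "i < length \<eta>"
    then show "e i = \<eta> ! i" using eg[of i 0] by (simp add: g0 m_def)
  qed
  have least: "e n \<le> f n" if f: "binomid_extension \<eta> f" and eq: "\<forall>i<n. f i = e i" for f n
  proof (cases "n < m")
    case True
    then show ?thesis using ext f by (simp add: binomid_extension_def m_def)
  next
    case False
    then obtain j where j: "n = m + j" by (metis le_add_diff_inverse not_less)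
    have "binomid_index (enat (Suc n)) f"
      using f by (simp add: binomid_extension_def binomid_index_infinity_iff)
    also have "?this \<longleftrightarrow> binomid_index (enat (Suc n)) ((g j)(n := f n))"
      using eq eg[of _ j] j by (intro binomid_index_cong) (auto simp: less_Suc_eq)
    finally have "(LEAST x. binomid_index (enat (Suc n)) ((g j)(n := x))) \<le> f n"
      by (rule Least_le)
    moreover have "e n = g (Suc j) n" using eg[of n "Suc j"] j by simp
    ultimately show ?thesis by (simp add: gS step_def j)
  qed
  have min: "\<not> less_fun f e" if "binomid_extension \<eta> f" for f
    using least[OF that] by (meson less_funE linorder_not_less)
  show ?thesis
  proof (rule ex1I)
    show "is_lex_min_extension \<eta> e"
      using ext min by (simp add: is_lex_min_extension_def)
  next
    fix f assume f: "is_lex_min_extension \<eta> f"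
    show "f = e"
    proof (rule ccontr)
      assume "f \<noteq> e"
      then obtain i where "f i \<noteq> e i" by blast
      define n where "n = (LEAST i. f i \<noteq> e i)"
      have "f n \<noteq> e n" using \<open>f i \<noteq> e i\<close> unfolding n_def by (rule LeastI)
      moreover have eq: "\<forall>i<n. f i = e i" unfolding n_def using not_less_Least by blast
      moreover have "e n \<le> f n"
        using f least eq by (simp add: is_lex_min_extension_def)
      ultimately have "less_fun e f" unfolding less_fun_def by (intro exI[of _ n]) auto
      then show False using f ext by (simp add: is_lex_min_extension_def)
    qed
  qed
qed

lemma preperiod_iff:
  "preperiod q e \<longleftrightarrow> (\<exists>p>0. \<forall>i\<ge>q. e (i + p) = e i)"
proof
  assume "preperiod q e"
  then obtain u v where uv: "length u = q" "v \<noteq> []" "e = append_repeat u v"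
    by (auto simp: preperiod_def)
  have "e (i + length v) = e i" if "i \<ge> q" for i
  proof -
    have "(i + length v - q) mod length v = ((i - q) + length v) mod length v"
      using that by simp
    then have "(i + length v - q) mod length v = (i - q) mod length v"
      by (simp only: mod_add_self2)
    then show ?thesis using that uv by (simp add: append_repeat_def)
  qed
  then show "\<exists>p>0. \<forall>i\<ge>q. e (i + p) = e i" using uv(2) by blast
next
  assume "\<exists>p>0. \<forall>i\<ge>q. e (i + p) = e i"
  then obtain p where p: "p > 0" "\<forall>i\<ge>q. e (i + p) = e i" by blast
  have per: "e (i + n * p) = e i" if "i \<ge> q" for i n
  proof (induction n)
    case (Suc n)
    have "e (i + Suc n * p) = e ((i + n * p) + p)" by (simp add: algebra_simps)
    also have "\<dots> = e (i + n * p)" using p that by simp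
    finally show ?case using Suc by simp
  qed simp
  define u v where "u = map e [0..<q]" and "v = map e [q..<q + p]"
  have "e i = append_repeat u v i" for i
  proof (cases "i < q")
    case False
    have "i = (q + (i - q) mod p) + ((i - q) div p) * p" using False by simp
    then have "e i = e (q + (i - q) mod p)" by (metis per le_add1)
    then show ?thesis using False p(1) by (simp add: append_repeat_def u_def v_def)
  qed (simp add: append_repeat_def u_def)
  then show "preperiod q e"
    unfolding preperiod_def using p(1)
    by (intro exI[of _ u] exI[of _ v]) (auto simp: u_def v_def)
qed

end

(* An index is binomid iff its partial sums S are superadditive, and lexicographic minimality
   forces S n = S a + S b for some splitting n = a + b of every n > m. Hence S n is the value of an
   optimal partition of n into parts of size at most m, a part i having value S i (an unbounded
   knapsack problem). If n > k m (m + 1) / 2, then some part i occurs at least k times. As k has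
   maximal average, k copies of i can be traded for i copies of k without loss, so an optimal
   partition contains k and S n = S k + S (n - k). *)

theory Submission
  imports Defs
begin

definition superadditive :: "(nat \<Rightarrow> nat) \<Rightarrow> bool" where
  "superadditive S \<longleftrightarrow> (\<forall>a b. S a + S b \<le> S (a + b))"

lemma superadditiveD: "superadditive S \<Longrightarrow> S a + S b \<le> S (a + b)"
  by (simp add: superadditive_def)

lemma superadditive_mult:
  assumes "superadditive S"
  shows "c * S i \<le> S (c * i)"
proof (induction c)
  case (Suc c)
  then show ?case using superadditiveD[OF assms, of i "c * i"] by simp
qed simp

text \<open>In knapsack terms this is optimality: no partition of n, with \<open>c i\<close> copies
  of each part i, is worth more than S n. It later values the parts left over after a trade.\<close>

lemma superadditive_sum:
  assumes "superadditive S" "finite A"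
  shows "(\<Sum>i\<in>A. c i * S i) \<le> S (\<Sum>i\<in>A. c i * i)"
  using assms(2)
proof (induction A)
  case (insert x A)
  then show ?case
    using superadditive_mult[OF assms(1), of "c x" x]
      superadditiveD[OF assms(1), of "c x * x" "\<Sum>i\<in>A. c i * i"] by simp
qed simp

text \<open>The window sum over \<open>{n-k..<n}\<close> is S n - S (n-k), so the condition compares
  S k + S (n-k) with S n. The case a = 0, excluded by \<open>1 \<le> k\<close>, is trivial because S
  0 = 0.\<close>

lemma binomid_index_infinity_iff_superadditive:
  "binomid_index \<infinity> e \<longleftrightarrow> superadditive (partial_sum e)"
proof -
  have "partial_sum e (n - k) + (\<Sum>i=n-k..<n. e i) = partial_sum e n" for k n
    unfolding partial_sum_def lessThan_atLeast0
    by (rule sum.atLeastLessThan_concat) auto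
  then have "partial_sum e k \<le> (\<Sum>i=n-k..<n. e i) \<longleftrightarrow>
      partial_sum e k + partial_sum e (n - k) \<le> partial_sum e n" for k n
    by (metis add.commute add_le_cancel_left)
  then have "binomid_index \<infinity> e \<longleftrightarrow>
      (\<forall>k n. 1 \<le> k \<longrightarrow> k \<le> n \<longrightarrow> partial_sum e k + partial_sum e (n - k) \<le> partial_sum e n)"
    unfolding binomid_index_def partial_sum_def[symmetric] by simp
  also have "\<dots> \<longleftrightarrow> superadditive (partial_sum e)"
    unfolding superadditive_def
  proof (intro iffI allI impI)
    fix a b
    assume *: "\<forall>k n. 1 \<le> k \<longrightarrow> k \<le> n \<longrightarrow> partial_sum e k + partial_sum e (n - k) \<le> partial_sum e n"
    show "partial_sum e a + partial_sum e b \<le> partial_sum e (a + b)"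
    proof (cases "a = 0")
      case False
      then show ?thesis using *[rule_format, of a "a + b"] by simp
    qed (simp add: partial_sum_def)
  next
    fix k n :: nat
    assume "\<forall>a b. partial_sum e a + partial_sum e b \<le> partial_sum e (a + b)" "k \<le> n"
    then show "partial_sum e k + partial_sum e (n - k) \<le> partial_sum e n"
      by (metis le_add_diff_inverse)
  qed
  finally show ?thesis .
qed

text \<open>If every splitting of n were strict, S n could be lowered by one and S would stay
  superadditive. The first entry to change lies beyond \<eta> and decreases, against
  minimality.\<close>

lemma lex_min_extension_splits:
  assumes min: "is_lex_min_extension \<eta> e" and n: "length \<eta> < n" "2 \<le> n"
  shows "\<exists>a b. 1 \<le> a \<and> 1 \<le> b \<and> n = a + b \<and> partial_sum e n = partial_sum e a + partial_sum e b"
proof (rule ccontr)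
  assume no_split: "\<not> ?thesis"
  have ext: "binomid_extension \<eta> e" and least: "binomid_extension \<eta> f \<Longrightarrow> \<not> less_fun f e" for f
    using min by (auto simp: is_lex_min_extension_def)
  have super: "superadditive (partial_sum e)"
    using ext by (simp add: binomid_extension_def binomid_index_infinity_iff_superadditive)
  have strict: "partial_sum e a + partial_sum e b < partial_sum e n"
    if "1 \<le> a" "1 \<le> b" "n = a + b" for a b
    using no_split that superadditiveD[OF super, of a b] by fastforce
  obtain l where l: "n = Suc l" using n by (cases n) auto
  \<comment> \<open>The splitting n = l + 1 into positive parts exists since
    \<open>2 \<le> n\<close>. It gives e l > S 1, so \<open>e l - 1\<close> below is not
    truncated.\<close>
  have "partial_sum e l + partial_sum e 1 < partial_sum e n"
    using strict[of l 1] l n by simp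
  then have pos: "0 < e l" by (simp add: partial_sum_def l)
  \<comment> \<open>Moving one unit from position l to position n lowers S only at n, which the strict
    inequality allows.\<close>
  define f where "f = e(l := e l - 1, n := e n + 1)"
  have sums: "partial_sum f j = (if j = n then partial_sum e n - 1 else partial_sum e j)" for j
  proof -
    have lt: "partial_sum f j = partial_sum e j" if "j \<le> l" for j
      unfolding partial_sum_def by (rule sum.cong) (use that l in \<open>auto simp: f_def\<close>)
    have at: "partial_sum f n + 1 = partial_sum e n"
      using lt[of l] pos by (simp add: partial_sum_def l f_def)
    have gt: "partial_sum f (Suc n + d) = partial_sum e (Suc n + d)" for d
    proof (induction d)
      case 0
      then show ?case using at by (simp add: partial_sum_def f_def)
    next
      case (Suc d)
      then show ?case by (simp add: partial_sum_def f_def l)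
    qed
    consider "j \<le> l" | "j = n" | d where "j = Suc n + d"
      using l by (metis le_Suc_eq le_iff_add not_less_eq_eq)
    then show ?thesis using lt at gt l by cases auto
  qed
  have "superadditive (partial_sum f)"
    unfolding superadditive_def
  proof (intro allI)
    fix a b
    show "partial_sum f a + partial_sum f b \<le> partial_sum f (a + b)"
    proof (cases "a = 0 \<or> b = 0")
      case True
      then show ?thesis by (auto simp: partial_sum_def)
    next
      case False
      \<comment> \<open>The right side drops only if a + b = n, where \<open>strict\<close> leaves
        room for one unit; on the left a drop only helps.\<close>
      then show ?thesis
        using strict[of a b] superadditiveD[OF super, of a b] by (auto simp: sums)
    qed
  qed
  moreover have "f i = \<eta> ! i" if "i < length \<eta>" for i
    using that ext n l by (auto simp: f_def binomid_extension_def)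
  ultimately have "binomid_extension \<eta> f"
    by (simp add: binomid_extension_def binomid_index_infinity_iff_superadditive)
  moreover have "less_fun f e"
    unfolding less_fun_def by (rule exI[of _ l]) (use pos l in \<open>auto simp: f_def\<close>)
  ultimately show False using least by blast
qed

text \<open>Split repeatedly until all parts are at most m; both parts being positive makes this
  terminate. Recording multiplicities turns the union of two partitions into pointwise
  addition.\<close>

lemma split_imp_partition:
  fixes S :: "nat \<Rightarrow> nat"
  assumes "S 0 = 0"
    and split: "\<And>n. m < n \<Longrightarrow> \<exists>a b. 1 \<le> a \<and> 1 \<le> b \<and> n = a + b \<and> S n = S a + S b"
  shows "\<exists>c. n = (\<Sum>i=1..m. c i * i) \<and> S n = (\<Sum>i=1..m. c i * S i)"
proof (induction n rule: less_induct)
  case (less n)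
  consider "n = 0" | "1 \<le> n" "n \<le> m" | "m < n" by linarith
  then show ?case
  proof cases
    case 1
    then show ?thesis using assms(1) by (intro exI[of _ "\<lambda>_. 0"]) simp
  next
    case 2
    then show ?thesis
      by (intro exI[of _ "\<lambda>i. if i = n then 1 else 0"])
        (simp add: if_distrib[of "\<lambda>x. x * _"] sum.delta cong: if_cong)
  next
    case 3
    then obtain a b where ab: "1 \<le> a" "1 \<le> b" "n = a + b" "S n = S a + S b"
      using split by blast
    obtain c where "a = (\<Sum>i=1..m. c i * i)" "S a = (\<Sum>i=1..m. c i * S i)"
      using less[of a] ab by auto
    moreover obtain d where "b = (\<Sum>i=1..m. d i * i)" "S b = (\<Sum>i=1..m. d i * S i)"
      using less[of b] ab by auto
    ultimately show ?thesis
      using ab by (intro exI[of _ "\<lambda>i. c i + d i"]) (simp add: add_mult_distrib sum.distrib)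
  qed
qed

lemma partition_trade:
  fixes S :: "nat \<Rightarrow> nat"
  assumes super: "superadditive S"
    and n: "n = (\<Sum>i=1..m. c i * i)" "S n = (\<Sum>i=1..m. c i * S i)"
    and large: "k * m * (m + 1) div 2 < n"
    and best: "\<And>i. i \<in> {1..m} \<Longrightarrow> k * S i \<le> i * S k"
  shows "k \<le> n \<and> S n = S k + S (n - k)"
proof -
  have "\<exists>i\<in>{1..m}. k \<le> c i"
  proof (rule ccontr)
    assume "\<not> ?thesis"
    then have "n \<le> (\<Sum>i=1..m. k * i)"
      unfolding n(1) by (intro sum_mono mult_right_mono) (auto simp: not_le less_imp_le)
    also have "\<dots> = k * (m * (m + 1) div 2)"
      by (use gauss_sum_from_Suc_0[where 'a = nat, of m] in \<open>simp add: sum_distrib_left[symmetric]\<close>)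
    \<comment> \<open>The factor k may enter the division because m (m + 1) is even.\<close>
    also have "\<dots> = k * m * (m + 1) div 2"
      by (subst div_mult_swap) (simp_all only: mult.assoc even_mult_iff even_add odd_one, simp)
    finally show False using large by simp
  qed
  then obtain i where i: "i \<in> {1..m}" "k \<le> c i" by blast
  \<comment> \<open>What remains once k copies of i are removed. The identity \<open>trade\<close>
    is needed for two weights g: the sizes j and the values S j.\<close>
  define r where "r = c(i := c i - k)"
  have trade: "(\<Sum>j=1..m. c j * g j) = k * g i + (\<Sum>j=1..m. r j * g j)" for g :: "nat \<Rightarrow> nat"
  proof -
    have "(\<Sum>j=1..m. c j * g j) = (\<Sum>j=1..m. (if j = i then k * g i else 0) + r j * g j)"
      by (rule sum.cong)
        (use i in \<open>auto simp: r_def add_mult_distrib[symmetric]\<close>)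
    then show ?thesis using i by (simp add: sum.distrib)
  qed
  define t where "t = (\<Sum>j=1..m. r j * j)"
  \<comment> \<open>One of the i new copies of k is set aside; the other i' copies together with the
    remainder t make up n - k.\<close>
  obtain i' where i': "i = Suc i'" using i by (cases i) auto
  have nt: "n = k + (i' * k + t)"
    using trade[of "\<lambda>j. j"] n(1) by (simp add: t_def i' algebra_simps)
  have "S n \<le> i * S k + S t"
    using trade[of S] n(2) best[OF i(1)] superadditive_sum[OF super, of "{1..m}" r]
    by (simp add: t_def)
  also have "\<dots> \<le> S k + S (i' * k + t)"
    using superadditive_mult[OF super, of i' k] superadditiveD[OF super, of "i' * k" t]
    by (simp add: i')
  finally show ?thesis
    using superadditiveD[OF super, of k "i' * k + t"] nt by simp
qed

theorem theorem3p5: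
  fixes m k :: nat and \<eta> :: "nat list"
  assumes "1 \<le> m"
    and "length \<eta> = m"
    and "fin_binomid_index \<eta>"
    and "k \<in> {i. 1 \<le> i \<and> i \<le> m \<and>
           average (lex_min_extension \<eta>) i = Max (average (lex_min_extension \<eta>) ` {1..m})}"
  shows "preperiod (k * m * (m + 1) div 2) (lex_min_extension \<eta>)"
proof -
  define e where "e = lex_min_extension \<eta>"
  define S where "S = partial_sum e"
  define q where "q = k * m * (m + 1) div 2"
  have min: "is_lex_min_extension \<eta> e"
    unfolding e_def lex_min_extension_def
    using lex_min_extension_unique_existence[OF assms(3)] by (rule theI')
  then have super: "superadditive S"
    by (simp add: S_def is_lex_min_extension_def binomid_extension_def
        binomid_index_infinity_iff_superadditive)
  have k: "1 \<le> k" "average e k = Max (average e ` {1..m})"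
    using assms(4) by (auto simp: e_def)
  have best: "k * S i \<le> i * S k" if i: "i \<in> {1..m}" for i
  proof -
    have "average e i \<le> average e k" unfolding k(2) using i by (intro Max_ge) auto
    then have "real (k * S i) \<le> real (i * S k)"
      using i k(1) by (simp add: average_def S_def divide_simps mult.commute)
    then show ?thesis by (simp only: of_nat_le_iff)
  qed
  have partition: "\<exists>c. n = (\<Sum>i=1..m. c i * i) \<and> S n = (\<Sum>i=1..m. c i * S i)" for n
  proof (rule split_imp_partition)
    show "S 0 = 0" by (simp add: S_def partial_sum_def)
    show "\<exists>a b. 1 \<le> a \<and> 1 \<le> b \<and> n = a + b \<and> S n = S a + S b" if "m < n" for n
      unfolding S_def by (rule lex_min_extension_splits[OF min]) (use that assms(1,2) in auto)
  qed
  have rec: "S n = S k + S (n - k)" if large: "q < n" for n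
  proof -
    obtain c where c: "n = (\<Sum>i=1..m. c i * i)" "S n = (\<Sum>i=1..m. c i * S i)"
      using partition by blast
    show ?thesis using partition_trade[OF super c large[unfolded q_def] best] by blast
  qed
  \<comment> \<open>Subtract the recurrence at i + k from the one at i + k + 1. Both apply already
    for i = q, since \<open>1 \<le> k\<close> gives q < i + k.\<close>
  have "e (i + k) = e i" if "q \<le> i" for i
  proof -
    have "S (Suc j) = S j + e j" for j by (simp add: S_def partial_sum_def)
    from this[of i] this[of "i + k"] show ?thesis
      using rec[of "Suc (i + k)"] rec[of "i + k"] that k(1) by (simp add: Suc_diff_le)
  qed
  then show ?thesis
    unfolding preperiod_iff q_def[symmetric] e_def[symmetric] using k(1) by (intro exI[of _ k]) auto
qed

end
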